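(* Let $(J,\mathcal{B})$ be a set algebra, and let $\varphi\colon\mathcal{B}\to\mathbb{R}$ be an increasing, strongly bounded submodular set function with $\varphi(\emptyset)=0$. Let $\varphi^{*}$ be the canonical dual of $\varphi$ and $\varphi^{**}=(\varphi^{*})^{*}$. Then $\underline{\varphi}:=\varphi-\varphi^{**}$ is a nonnegative charge. Furthermore, $\underline{\varphi}$ is the unique largest charge $\alpha$ on $(J,\mathcal{B})$ such that $\varphi-\alpha$ is increasing; that is, $\varphi-\underline{\varphi}$ is increasing, and every charge $\alpha$ on $(J,\mathcal{B})$ for which $\varphi-\alpha$ is increasing satisfies $\alpha(X)\le\underline{\varphi}(X)$ for all $X\in\mathcal{B}$.
   Context: A set algebra $(J,\mathcal{B})$ is a set $J$ with a family $\mathcal{B}$ of subsets of $J$ closed under complements and finite unions; members of $\mathcal{B}$ are called measurable. A set function $\varphi\colon\mathcal{B}\to\mathbb{R}$ is increasing if $X\subseteq Y$ implies $\varphi(X)\le\varphi(Y)$, and submodular if $\varphi(X)+\varphi(Y)\ge\varphi(X\cap Y)+\varphi(X\cup Y)$ for all $X,Y\in\mathcal{B}$. A charge is a (not necessarily nonnegative) real-valued finitely additive measure on $\mathcal{B}$. For a nonnegative submodular set function $\varphi$ with $\varphi(\emptyset)=0$, define $\widehat{\varphi}(X)=\sup\sum_{i=1}^n\varphi(X_i)$, where $\{X_1,\dots,X_n\}$ ranges over all finite measurable partitions of $X$, and $\widehat{\varphi}(\emptyset)=0$. The function $\varphi$ is strongly bounded if $\widehat{\varphi}$ takes only finite values.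 In that case the canonical dual of an increasing $\varphi$ is $\varphi^{*}(X)=\varphi(J\setminus X)+\widehat{\varphi}(X)-\varphi(J)$ for $X\in\mathcal{B}$; it is again an increasing, strongly bounded submodular set function with $\varphi^*(\emptyset)=0$, and $\varphi^{**}$ is obtained by applying the same construction to $\varphi^{*}$ (using $\widehat{\varphi^{*}}$). *)

theory Defs
  imports "HOL-Analysis.Analysis"
begin

text \<open>
  Set functions are total functions \<open>'a set \<Rightarrow> real\<close>; only their values on the set algebra \<open>B\<close>
  are relevant. Set algebras, finite additivity and monotonicity are \<^const>\<open>algebra\<close>,
  \<^const>\<open>Measure_Space.additive\<close> and \<^const>\<open>increasing\<close> from the library.
\<close>

definition submodular :: "'a set set \<Rightarrow> ('a set \<Rightarrow> real) \<Rightarrow> bool" where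
  "submodular B \<phi> \<longleftrightarrow>
    (\<forall>X\<in>B. \<forall>Y\<in>B. \<phi> X + \<phi> Y \<ge> \<phi> (X \<inter> Y) + \<phi> (X \<union> Y))"

definition charge :: "'a set set \<Rightarrow> ('a set \<Rightarrow> real) \<Rightarrow> bool" where
  "charge B \<alpha> \<longleftrightarrow> Measure_Space.additive B \<alpha>"

text \<open>
  The supremum is taken in the extended reals, so that it may be infinite. The only partition of
  \<open>{}\<close> in the sense of \<^const>\<open>partition_on\<close> is the empty one, so the value at \<open>{}\<close> is \<open>0\<close>.
\<close>

definition hat :: "'a set set \<Rightarrow> ('a set \<Rightarrow> real) \<Rightarrow> 'a set \<Rightarrow> ereal" where
  "hat B \<phi> X = (SUP P\<in>{P. finite P \<and> P \<subseteq> B \<and> partition_on X P}. ereal (\<Sum>Y\<in>P. \<phi> Y))"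

definition strongly_bounded :: "'a set set \<Rightarrow> ('a set \<Rightarrow> real) \<Rightarrow> bool" where
  "strongly_bounded B \<phi> \<longleftrightarrow> (\<forall>X\<in>B. \<bar>hat B \<phi> X\<bar> \<noteq> \<infinity>)"

text \<open>Meaningful for strongly bounded \<open>\<phi>\<close>, where \<^const>\<open>real_of_ereal\<close> loses no information.\<close>

definition canonical_dual :: "'a set \<Rightarrow> 'a set set \<Rightarrow> ('a set \<Rightarrow> real) \<Rightarrow> 'a set \<Rightarrow> real" where
  "canonical_dual J B \<phi> X = \<phi> (J - X) + real_of_ereal (hat B \<phi> X) - \<phi> J"

definition lower_charge :: "'a set \<Rightarrow> 'a set set \<Rightarrow> ('a set \<Rightarrow> real) \<Rightarrow> 'a set \<Rightarrow> real" where
  "lower_charge J B \<phi> X = \<phi> X - canonical_dual J B (canonical_dual J B \<phi>) X"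

definition is_largest_charge_below ::
    "'a set set \<Rightarrow> ('a set \<Rightarrow> real) \<Rightarrow> ('a set \<Rightarrow> real) \<Rightarrow> bool" where
  "is_largest_charge_below B \<phi> \<beta> \<longleftrightarrow>
    charge B \<beta> \<and> increasing B (\<lambda>X. \<phi> X - \<beta> X) \<and>
    (\<forall>\<alpha>. charge B \<alpha> \<and> increasing B (\<lambda>X. \<phi> X - \<alpha> X) \<longrightarrow> (\<forall>X\<in>B. \<alpha> X \<le> \<beta> X))"

end

theory Submission
  imports Defs
begin

text \<open>
  Write \<open>h\<close> for the hat of \<open>\<phi>\<close>. A submodular \<open>\<phi>\<close> that vanishes at \<open>{}\<close> is subadditive, so
  refining a partition can only increase the sum of \<open>\<phi>\<close> over its members; this makes \<open>h\<close> additive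
  (\<open>additive_real_hat\<close>). On the other hand any charge above \<open>\<phi>\<close> bounds all these sums
  (\<open>real_hat_le_additive\<close>). Hence \<open>h\<close> is the least charge above \<open>\<phi>\<close>.

  Let \<open>\<psi>\<close> be the canonical dual of \<open>\<phi>\<close>. It is again increasing and submodular, vanishes at \<open>{}\<close>,
  and lies below \<open>h\<close>, so its hat \<open>k\<close> is a charge as well. Since \<open>\<psi> J = h J - \<phi> J\<close>, expanding the
  definition shows that the second dual takes at \<open>X\<close> the value
  \<open>\<phi> X + h (J - X) - h J + k X = \<phi> X - h X + k X\<close>, that is, the lower charge is
  simply \<open>h - k\<close> (\<open>lower_charge_eq\<close>). It is a difference of charges, it is nonnegative because \<open>k\<close>
  is the least charge above \<open>\<psi>\<close> while \<open>h\<close> is one such charge, and \<open>\<phi> - (h - k)\<close> is the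
  second dual, which is increasing.

  Finally, if \<open>\<phi> - \<alpha>\<close> is increasing for a charge \<open>\<alpha>\<close>, comparing its values at \<open>J - Y\<close> and \<open>J\<close>
  gives \<open>\<alpha> Y \<le> \<phi> J - \<phi> (J - Y)\<close>, which says precisely that \<open>\<psi> Y \<le> h Y - \<alpha> Y\<close>. So the charge
  \<open>h - \<alpha>\<close> lies above \<open>\<psi>\<close>, hence above \<open>k\<close>, and therefore \<open>\<alpha> \<le> h - k\<close>.
\<close>

section \<open>The hat as the least charge above a set function\<close>

abbreviation real_hat :: "'a set set \<Rightarrow> ('a set \<Rightarrow> real) \<Rightarrow> 'a set \<Rightarrow> real" where
  "real_hat B \<phi> X \<equiv> real_of_ereal (hat B \<phi> X)"

lemma strongly_boundedD:
  assumes "strongly_bounded B \<phi>" "X \<in> B"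
  shows "hat B \<phi> X = ereal (real_hat B \<phi> X)"
  using assms unfolding strongly_bounded_def by (simp add: ereal_real)

lemma sum_le_real_hat:
  assumes "strongly_bounded B \<phi>" "X \<in> B" "finite P" "P \<subseteq> B" "partition_on X P"
  shows "sum \<phi> P \<le> real_hat B \<phi> X"
proof -
  have "ereal (sum \<phi> P) \<le> hat B \<phi> X"
    unfolding hat_def by (rule SUP_upper) (use assms in auto)
  then show ?thesis
    using strongly_boundedD[OF assms(1,2)] by (metis ereal_less_eq(3))
qed

lemma real_hat_least:
  assumes "strongly_bounded B \<phi>" "X \<in> B"
    and bound: "\<And>P. finite P \<Longrightarrow> P \<subseteq> B \<Longrightarrow> partition_on X P \<Longrightarrow> sum \<phi> P \<le> c"
  shows "real_hat B \<phi> X \<le> c"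
proof -
  have "hat B \<phi> X \<le> ereal c"
    unfolding hat_def by (rule SUP_least) (use bound in auto)
  then show ?thesis
    using strongly_boundedD[OF assms(1,2)] by (metis ereal_less_eq(3))
qed

lemma le_real_hat:
  assumes "strongly_bounded B \<phi>" "\<phi> {} = 0" "X \<in> B"
  shows "\<phi> X \<le> real_hat B \<phi> X"
proof (cases "X = {}")
  case True
  then show ?thesis
    using sum_le_real_hat[OF assms(1,3), of "{}"] assms(2) by (simp add: partition_on_empty)
next
  case False
  then show ?thesis
    using sum_le_real_hat[OF assms(1,3), of "{X}"] assms(3) by (simp add: partition_on_space)
qed

lemma submodular_imp_subadditive:
  assumes "submodular B \<phi>" "\<phi> {} = (0::real)"
  shows "subadditive B \<phi>"
  using assms unfolding submodular_def subadditive_def by fastforce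

context ring_of_sets
begin

lemma additive_Diff:
  fixes \<mu> :: "'a set \<Rightarrow> real"
  assumes "additive M \<mu>" "X \<in> M" "Y \<in> M" "X \<subseteq> Y"
  shows "\<mu> (Y - X) = \<mu> Y - \<mu> X"
  using additiveD[OF assms(1), of X "Y - X"] Diff[of Y X] assms
  by (simp add: Un_absorb1)

lemma additive_empty:
  fixes \<mu> :: "'a set \<Rightarrow> real"
  assumes "additive M \<mu>"
  shows "\<mu> {} = 0"
  using additiveD[OF assms, of "{}" "{}"] by simp

lemma additive_sum_partition:
  fixes \<mu> :: "'a set \<Rightarrow> real"
  assumes "additive M \<mu>" "finite P" "P \<subseteq> M" "disjoint P"
  shows "sum \<mu> P = \<mu> (\<Union>P)"
  using assms(2-)
proof (induction P)
  case empty
  then show ?case by (simp add: additive_empty[OF assms(1)])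
next
  case (insert Y P)
  have "Y \<inter> \<Union>P = {}" "\<Union>P \<in> M"
    using insert by (auto simp: pairwise_insert disjnt_def)
  then have "\<mu> (Y \<union> \<Union>P) = \<mu> Y + \<mu> (\<Union>P)"
    using insert.prems additiveD[OF assms(1)] by blast
  then show ?case
    using insert by (simp add: pairwise_insert)
qed

lemma sum_le_additive:
  fixes \<mu> :: "'a set \<Rightarrow> real"
  assumes "additive M \<mu>" "\<And>Y. Y \<in> M \<Longrightarrow> \<phi> Y \<le> \<mu> Y"
    and "finite P" "P \<subseteq> M" "partition_on X P"
  shows "sum \<phi> P \<le> \<mu> X"
proof -
  have "sum \<phi> P \<le> sum \<mu> P"
    using assms by (intro sum_mono) auto
  also have "\<dots> = \<mu> X"
    using additive_sum_partition[OF assms(1,3,4)] assms(5) by (simp add: partition_on_def)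
  finally show ?thesis .
qed

lemma strongly_bounded_if_le_additive:
  fixes \<mu> :: "'a set \<Rightarrow> real"
  assumes "additive M \<mu>" "\<And>Y. Y \<in> M \<Longrightarrow> \<phi> Y \<le> \<mu> Y"
  shows "strongly_bounded M \<phi>"
  unfolding strongly_bounded_def
proof
  fix X assume X: "X \<in> M"
  have upper: "hat M \<phi> X \<le> ereal (\<mu> X)"
    unfolding hat_def by (rule SUP_least) (use sum_le_additive[OF assms] in auto)
  \<comment> \<open>Any single partition bounds the hat from below; removing the empty set covers \<open>X = {}\<close>.\<close>
  have "partition_on X ({X} - {{}})"
    by (cases "X = {}") (auto simp: partition_on_empty partition_on_space)
  then have "ereal (sum \<phi> ({X} - {{}})) \<le> hat M \<phi> X"
    unfolding hat_def by (intro SUP_upper) (use X in auto)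
  with upper show "\<bar>hat M \<phi> X\<bar> \<noteq> \<infinity>"
    by (cases "hat M \<phi> X") auto
qed

lemma real_hat_le_additive:
  fixes \<mu> :: "'a set \<Rightarrow> real"
  assumes "additive M \<mu>" "\<And>Y. Y \<in> M \<Longrightarrow> \<phi> Y \<le> \<mu> Y" "X \<in> M"
  shows "real_hat M \<phi> X \<le> \<mu> X"
  using assms
  by (intro real_hat_least[OF strongly_bounded_if_le_additive] sum_le_additive) auto

text \<open>
  Cutting a partition of a larger set down to \<open>X\<close> yields sums that the hat of \<open>X\<close> controls.
  Nonempty traces of distinct members of a partition are distinct. The empty trace may occur several
  times, but it contributes nothing.
\<close>

lemma sum_trace_le_real_hat:
  assumes "strongly_bounded M \<phi>" "\<phi> {} = 0"
    and "finite P" "P \<subseteq> M" "partition_on Z P" "X \<in> M" "X \<subseteq> Z"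
  shows "(\<Sum>Y\<in>P. \<phi> (X \<inter> Y)) \<le> real_hat M \<phi> X"
proof -
  have disj: "disjoint P"
    using assms(5) by (rule partition_onD2)
  have "(\<Sum>Y\<in>P. \<phi> (X \<inter> Y)) = sum \<phi> ((\<inter>) X ` P)"
  proof (rule sum.reindex_nontrivial[symmetric, unfolded o_def])
    fix U V assume "U \<in> P" "V \<in> P" "U \<noteq> V" and eq: "X \<inter> U = X \<inter> V"
    then have "U \<inter> V = {}"
      using disj by (auto simp: disjoint_def)
    then have "X \<inter> U = {}"
      using eq by blast
    then show "\<phi> (X \<inter> U) = 0"
      using assms(2) by simp
  qed (fact assms)
  also have "\<dots> = sum \<phi> ((\<inter>) X ` P - {{}})"
    by (rule sum.mono_neutral_right) (use assms in auto)
  also have "\<dots> \<le> real_hat M \<phi> X"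
  proof (rule sum_le_real_hat)
    show "partition_on X ((\<inter>) X ` P - {{}})"
      using partition_on_restrict[OF assms(5), of X] assms(7) by (simp add: Int_absorb2)
  qed (use assms in auto)
  finally show ?thesis .
qed

text \<open>
  Joining partitions of two disjoint sets gives a partition of their union, so the hat of any set
  function is superadditive. Subadditivity of \<open>\<phi>\<close> is what allows a partition of the union to be cut
  along the two sets without losing value.
\<close>

lemma additive_real_hat:
  assumes sb: "strongly_bounded M \<phi>" and empty: "\<phi> {} = 0" and sub: "subadditive M \<phi>"
  shows "additive M (real_hat M \<phi>)"
  unfolding additive_def
proof (intro ballI impI)
  fix A C assume A: "A \<in> M" and C: "C \<in> M" and AC: "A \<inter> C = {}"
  show "real_hat M \<phi> (A \<union> C) = real_hat M \<phi> A + real_hat M \<phi> C"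
  proof (rule antisym)
    show "real_hat M \<phi> (A \<union> C) \<le> real_hat M \<phi> A + real_hat M \<phi> C"
    proof (rule real_hat_least[OF sb])
      fix P assume P: "finite P" "P \<subseteq> M" "partition_on (A \<union> C) P"
      have "sum \<phi> P \<le> (\<Sum>Y\<in>P. \<phi> (A \<inter> Y) + \<phi> (C \<inter> Y))"
      proof (rule sum_mono)
        fix Y assume Y: "Y \<in> P"
        have "Y = (A \<inter> Y) \<union> (C \<inter> Y)"
          using partition_onD1[OF P(3)] Y by blast
        moreover have "\<phi> ((A \<inter> Y) \<union> (C \<inter> Y)) \<le> \<phi> (A \<inter> Y) + \<phi> (C \<inter> Y)"
          using A C AC P(2) Y by (intro subadditiveD[OF sub]) auto
        ultimately show "\<phi> Y \<le> \<phi> (A \<inter> Y) + \<phi> (C \<inter> Y)"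
          by simp
      qed
      also have "\<dots> \<le> real_hat M \<phi> A + real_hat M \<phi> C"
        unfolding sum.distrib
        using A C by (intro add_mono sum_trace_le_real_hat[OF sb empty P]) auto
      finally show "sum \<phi> P \<le> real_hat M \<phi> A + real_hat M \<phi> C" .
    qed (use A C in auto)
    have join: "sum \<phi> P + sum \<phi> Q \<le> real_hat M \<phi> (A \<union> C)"
      if P: "finite P" "P \<subseteq> M" "partition_on A P" and Q: "finite Q" "Q \<subseteq> M" "partition_on C Q"
      for P Q
    proof -
      have apart: "U \<inter> V = {}" if "U \<in> P" "V \<in> Q" for U V
        using that AC partition_onD1[OF P(3)] partition_onD1[OF Q(3)] by blast
      then have "P \<inter> Q = {}"
        using partition_onD3[OF P(3)] by (metis Int_absorb disjoint_iff)
      then have "sum \<phi> P + sum \<phi> Q = sum \<phi> (P \<union> Q)"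
        using P Q by (simp add: sum.union_disjoint)
      moreover have "partition_on (A \<union> C) (P \<union> Q)"
      proof (rule partition_onI)
        fix U V assume "U \<in> P \<union> Q" "V \<in> P \<union> Q" "U \<noteq> V"
        then show "disjnt U V"
          using apart[of U V] apart[of V U] partition_onD2[OF P(3)] partition_onD2[OF Q(3)]
          by (elim UnE) (simp_all add: disjnt_def disjointD Int_commute)
      qed (use P(3) Q(3) in \<open>auto simp: partition_on_def\<close>)
      ultimately show ?thesis
        using sum_le_real_hat[OF sb, of "A \<union> C" "P \<union> Q"] A C P Q by auto
    qed
    have "real_hat M \<phi> A \<le> real_hat M \<phi> (A \<union> C) - real_hat M \<phi> C"
    proof (rule real_hat_least[OF sb A])
      fix P assume P: "finite P" "P \<subseteq> M" "partition_on A P"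
      have "real_hat M \<phi> C \<le> real_hat M \<phi> (A \<union> C) - sum \<phi> P"
        by (rule real_hat_least[OF sb C]) (use join[OF P] in \<open>simp add: le_diff_eq add.commute\<close>)
      then show "sum \<phi> P \<le> real_hat M \<phi> (A \<union> C) - real_hat M \<phi> C"
        by simp
    qed
    then show "real_hat M \<phi> A + real_hat M \<phi> C \<le> real_hat M \<phi> (A \<union> C)"
      by simp
  qed
qed

end

section \<open>The canonical dual\<close>

locale bounded_submodular = algebra J B for J :: "'a set" and B +
  fixes \<phi> :: "'a set \<Rightarrow> real"
  assumes incr: "increasing B \<phi>"
    and bounded: "strongly_bounded B \<phi>"
    and submod: "submodular B \<phi>"
    and empty: "\<phi> {} = 0"
begin

abbreviation h :: "'a set \<Rightarrow> real" where
  "h \<equiv> real_hat B \<phi>"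

abbreviation dual :: "'a set \<Rightarrow> real" where
  "dual \<equiv> canonical_dual J B \<phi>"

lemma subadd: "subadditive B \<phi>"
  using submod empty by (rule submodular_imp_subadditive)

lemma additive_h: "additive B h"
  using bounded empty subadd by (rule additive_real_hat)

lemma dual_empty: "dual {} = 0"
  using additive_empty[OF additive_h] by (simp add: canonical_dual_def)

lemma dual_space: "dual J = h J - \<phi> J"
  using empty by (simp add: canonical_dual_def)

lemma dual_le_h:
  assumes "X \<in> B"
  shows "dual X \<le> h X"
  using increasingD[OF incr, of "J - X" J] assms by (auto simp: canonical_dual_def)

text \<open>
  Passing from \<open>X\<close> to a larger \<open>Y\<close> costs \<open>\<phi> (J - X) - \<phi> (J - Y) \<le> \<phi> (Y - X)\<close> by subadditivity, and
  the hat gains at least as much.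
\<close>

lemma increasing_dual: "increasing B dual"
  unfolding increasing_def
proof (intro ballI impI)
  fix X Y assume X: "X \<in> B" and Y: "Y \<in> B" and XY: "X \<subseteq> Y"
  have "J - X = (J - Y) \<union> (Y - X)"
    using XY sets_into_space[OF Y] by blast
  then have "\<phi> (J - X) \<le> \<phi> (J - Y) + \<phi> (Y - X)"
    using subadditiveD[OF subadd, of "J - Y" "Y - X"] X Y by auto
  also have "\<phi> (Y - X) \<le> h (Y - X)"
    using X Y by (intro le_real_hat[OF bounded empty]) auto
  also have "h (Y - X) = h Y - h X"
    using additive_Diff[OF additive_h X Y XY] .
  finally show "dual X \<le> dual Y"
    by (simp add: canonical_dual_def)
qed

text \<open>
  Complementation exchanges unions and intersections, so it preserves submodularity; the remaining
  summands of the dual are modular.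
\<close>

lemma submodular_dual: "submodular B dual"
  unfolding submodular_def
proof (intro ballI)
  fix X Y assume X: "X \<in> B" and Y: "Y \<in> B"
  have "\<phi> (J - X) + \<phi> (J - Y) \<ge> \<phi> ((J - X) \<inter> (J - Y)) + \<phi> ((J - X) \<union> (J - Y))"
    using submod X Y unfolding submodular_def by blast
  moreover have "(J - X) \<inter> (J - Y) = J - (X \<union> Y)" "(J - X) \<union> (J - Y) = J - (X \<inter> Y)"
    by auto
  moreover have "h (X \<union> Y) = h X + h (Y - X)"
    using additiveD[OF additive_h, of X "Y - X"] X Y by auto
  moreover have "h (Y - X) = h Y - h (X \<inter> Y)"
    using additive_Diff[OF additive_h Int[OF X Y] Y] by (simp add: Diff_Int)
  ultimately show "dual (X \<inter> Y) + dual (X \<union> Y) \<le> dual X + dual Y"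
    by (simp add: canonical_dual_def)
qed

text \<open>
  The dual satisfies the hypotheses placed on \<open>\<phi>\<close>, so whatever is shown for \<open>\<phi>\<close> and its dual
  applies to the dual and the second dual. Finiteness of its hat comes from the charge \<open>h\<close> above it.
\<close>

lemma bounded_submodular_dual: "bounded_submodular J B dual"
  using increasing_dual submodular_dual dual_empty
    strongly_bounded_if_le_additive[OF additive_h dual_le_h]
  by unfold_locales

subsection \<open>The lower charge as a difference of two hats\<close>

text \<open>
  The dual takes the value \<open>h J - \<phi> J\<close> at \<open>J\<close>, which cancels the constants in the second dual:
  the two complementations undo each other and only the two hats remain.
\<close>

lemma lower_charge_eq:
  assumes "X \<in> B"
  shows "lower_charge J B \<phi> X = h X - real_hat B dual X"
proof -
  have "J - (J - X) = X"
    using sets_into_space[OF assms] by blast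
  then have "dual (J - X) = \<phi> X + (h J - h X) - \<phi> J"
    using additive_Diff[OF additive_h assms top sets_into_space[OF assms]]
    by (simp add: canonical_dual_def)
  then show ?thesis
    unfolding lower_charge_def canonical_dual_def[of J B dual] dual_space by simp
qed

lemma charge_lower_charge: "charge B (lower_charge J B \<phi>)"
proof -
  interpret D: bounded_submodular J B dual
    by (rule bounded_submodular_dual)
  show ?thesis
    using additive_h D.additive_h
    by (simp add: charge_def Measure_Space.additive_def lower_charge_eq Un)
qed

lemma lower_charge_nonneg:
  assumes "X \<in> B"
  shows "0 \<le> lower_charge J B \<phi> X"
  using real_hat_le_additive[OF additive_h dual_le_h assms] by (simp add: lower_charge_eq assms)

lemma increasing_minus_lower_charge: "increasing B (\<lambda>X. \<phi> X - lower_charge J B \<phi> X)"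
proof -
  interpret D: bounded_submodular J B dual
    by (rule bounded_submodular_dual)
  show ?thesis
    using D.increasing_dual by (simp add: lower_charge_def)
qed

text \<open>
  The difference of \<open>h\<close> and \<open>\<alpha>\<close> is a charge above the dual: in terms of complements, the
  inequality at \<open>Y\<close> says that \<open>\<phi> - \<alpha>\<close> does not decrease from \<open>J - Y\<close> to \<open>J\<close>.
\<close>

lemma charge_le_lower_charge:
  assumes "charge B \<alpha>" "increasing B (\<lambda>X. \<phi> X - \<alpha> X)" "X \<in> B"
  shows "\<alpha> X \<le> lower_charge J B \<phi> X"
proof -
  have \<alpha>: "Measure_Space.additive B \<alpha>"
    using assms(1) by (simp add: charge_def)
  have "Measure_Space.additive B (\<lambda>Y. h Y - \<alpha> Y)"
    using \<alpha> additive_h by (auto simp: Measure_Space.additive_def)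
  moreover have "dual Y \<le> h Y - \<alpha> Y" if Y: "Y \<in> B" for Y
  proof -
    have "\<phi> (J - Y) - \<alpha> (J - Y) \<le> \<phi> J - \<alpha> J"
      using increasingD[OF assms(2), of "J - Y" J] Y by auto
    then have "\<alpha> Y \<le> \<phi> J - \<phi> (J - Y)"
      using additive_Diff[OF \<alpha> Y top sets_into_space[OF Y]] by simp
    then show ?thesis
      by (simp add: canonical_dual_def)
  qed
  ultimately have "real_hat B dual X \<le> h X - \<alpha> X"
    using assms(3) by (rule real_hat_le_additive)
  then show ?thesis
    by (simp add: lower_charge_eq assms(3))
qed

end

theorem theorem3p1:
  fixes J :: "'a set" and B :: "'a set set" and \<phi> :: "'a set \<Rightarrow> real"
  assumes "algebra J B"
    and "increasing B \<phi>"
    and "strongly_bounded B \<phi>"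
    and "submodular B \<phi>"
    and "\<phi> {} = 0"
  shows "charge B (lower_charge J B \<phi>)
    \<and> (\<forall>X\<in>B. 0 \<le> lower_charge J B \<phi> X)
    \<and> is_largest_charge_below B \<phi> (lower_charge J B \<phi>)
    \<and> (\<forall>\<beta>. is_largest_charge_below B \<phi> \<beta> \<longrightarrow> (\<forall>X\<in>B. \<beta> X = lower_charge J B \<phi> X))"
proof -
  interpret bounded_submodular J B \<phi>
    using assms by (simp add: bounded_submodular_def bounded_submodular_axioms_def)
  have largest: "is_largest_charge_below B \<phi> (lower_charge J B \<phi>)"
    using charge_lower_charge increasing_minus_lower_charge charge_le_lower_charge
    by (simp add: is_largest_charge_below_def)
  have unique: "\<beta> X = lower_charge J B \<phi> X" if "is_largest_charge_below B \<phi> \<beta>" "X \<in> B" for \<beta> X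
  proof (rule antisym)
    show "\<beta> X \<le> lower_charge J B \<phi> X"
      using that charge_le_lower_charge by (simp add: is_largest_charge_below_def)
    show "lower_charge J B \<phi> X \<le> \<beta> X"
      using that charge_lower_charge increasing_minus_lower_charge
      by (simp add: is_largest_charge_below_def)
  qed
  show ?thesis
    by (intro conjI ballI allI impI charge_lower_charge lower_charge_nonneg largest unique)
qed

end
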